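(* Let $F$ be a field of characteristic $0$. Let $R$ be a Rota--Baxter operator of weight $1$ on $F[x,y]$ of the form $R(x^ny^m)=\alpha_{n,m}y^{n+m}$, $\alpha_{n,m}\in F$ ($n,m\in\mathbb{N}$), with $\mathrm{Im}\,R\not\subseteq F1$ and with $\alpha_{1,0},\alpha_{1,1},\alpha_{1,2}$ pairwise distinct. For $i\in\mathbb{N}$ put $$s_i=\frac{\alpha_{1,1}-\alpha_{1,i}}{\alpha_{1,0}-\alpha_{1,1}}.$$ Let $s_2\neq0,-1$. Then for all $m\geq 0$ $$s_{m+1}(1/s_2 - s_m) = s_m + 1.$$
   Context: $\mathbb{N}=\{0,1,2,\ldots\}$. $F1$ is the set of constant polynomials. A linear operator $R$ on an algebra $A$ over $F$ is a Rota--Baxter operator of weight $\lambda\in F$ if $R(a)R(b)=R\big(R(a)b+aR(b)+\lambda ab\big)$ for all $a,b\in A$. *)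

theory Defs
  imports "HOL-Computational_Algebra.Polynomial"
begin

text \<open>Associativity of the multiplication is part of the class \<open>ring\<close>;
  neither commutativity nor a unit is required.\<close>

locale algebra_over = vector_space scale
  for scale :: "'f::field \<Rightarrow> 'a::ring \<Rightarrow> 'a" +
  assumes scale_mult_left: "scale c (a * b) = scale c a * b"
    and scale_mult_right: "scale c (a * b) = a * scale c b"

locale rota_baxter_operator =
  algebra_over scale + Vector_Spaces.linear scale scale R
  for scale :: "'f::field \<Rightarrow> 'a::ring \<Rightarrow> 'a"
    and weight :: 'f
    and R :: "'a \<Rightarrow> 'a" +
  assumes rota_baxter: "R a * R b = R (R a * b + a * R b + scale weight (a * b))"

text \<open>\<open>F[x,y]\<close> is represented as \<open>F[x][y]\<close>, i.e. by the type \<open>'a poly poly\<close>: the outer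
  indeterminate is \<open>y\<close>, the inner one is \<open>x\<close>. Scalar multiplication is by elements of \<open>F\<close> only,
  so it differs from \<open>smult\<close>, whose scalars range over \<open>F[x]\<close>.\<close>

definition scale_xy :: "'a::field \<Rightarrow> 'a poly poly \<Rightarrow> 'a poly poly" where
  "scale_xy c p = smult [:c:] p"

definition var_x :: "'a::field poly poly" where
  "var_x = [:[:0, 1:]:]"

definition var_y :: "'a::field poly poly" where
  "var_y = [:0, 1:]"

definition constants_xy :: "'a::field poly poly set" where
  "constants_xy = range (\<lambda>c. [:[:c:]:])"

lemma algebra_over_scale_xy: "algebra_over (scale_xy :: 'a::field \<Rightarrow> _)"
proof
  fix a b :: 'a and p q :: "'a poly poly"
  have "[:a + b:] = [:a:] + [:b:]" by simp
  then show "scale_xy (a + b) p = scale_xy a p + scale_xy b p"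
    unfolding scale_xy_def by (simp only: smult_add_left)
  show "scale_xy a (p + q) = scale_xy a p + scale_xy a q"
    by (simp add: scale_xy_def smult_add_right)
  show "scale_xy a (scale_xy b p) = scale_xy (a * b) p"
    by (simp add: scale_xy_def mult.commute)
  show "scale_xy 1 p = p"
    by (simp add: scale_xy_def flip: one_pCons)
  show "scale_xy a (p * q) = scale_xy a p * q" "scale_xy a (p * q) = p * scale_xy a q"
    by (simp_all add: scale_xy_def)
qed

end

theory Submission imports Defs begin

text \<open>
  Evaluating the Rota--Baxter identity on pairs of monomials turns it into quadratic relations
  between the coefficients \<open>\<alpha> n m\<close>. For the pair \<open>x y\<^sup>m\<close>, \<open>x y\<^sup>l\<close> the relation contains the
  coefficient \<open>\<alpha> 2 (m + l)\<close>, which depends on \<open>m + l\<close> only; comparing two such pairs with the same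
  sum eliminates it and leaves relations purely between the numbers \<open>\<alpha> 1 i\<close>. They say that
  \<open>(\<alpha> 1 m - \<alpha> 1 (m + l + 1)) (\<alpha> 1 l - \<alpha> 1 (m + l + 1))\<close> is a function of \<open>m + l\<close>, and this
  property is invariant under affine changes of the sequence, so it passes on to the normalised
  sequence \<open>s\<close>, which starts with \<open>-1, 0\<close>. The pairs \<open>(m + 1, 0)\<close> and \<open>(m, 1)\<close> then yield the
  second order recursion \<open>s (m + 2) (1 - s (m + 1) + s m) = s (m + 1)\<close>
  (lemma \<open>second_order_recursion\<close>).

  The asserted first order recursion is an integrated form of this, and follows by induction. The
  induction step divides by \<open>s (m + 1)\<close>. If \<open>s (m + 1)\<close> vanished for some \<open>m > 0\<close>, then the two
  preceding instances of the first order recursion would give \<open>s m = -1\<close> and then \<open>s 2 = -1\<close>,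
  which is excluded (lemma \<open>first_order_recursion\<close>).
\<close>

lemma scale_xy_var_y_power_eq_iff:
  "scale_xy a (var_y ^ n) = scale_xy b (var_y ^ n) \<longleftrightarrow> a = b"
proof -
  have "scale_xy c (var_y ^ n) = monom [:c:] n" for c :: 'a
    by (simp add: scale_xy_def var_y_def monom_altdef)
  then show ?thesis
    by simp
qed

lemma rota_baxter_coefficient_relation:
  fixes R :: "'a::field poly poly \<Rightarrow> 'a poly poly"
  assumes RB: "rota_baxter_operator scale_xy w R"
    and form: "\<And>n m. R (var_x ^ n * var_y ^ m) = scale_xy (\<alpha> n m) (var_y ^ (n + m))"
  shows "\<alpha> n m * \<alpha> k l =
    \<alpha> n m * \<alpha> k (n + m + l) + \<alpha> k l * \<alpha> n (m + k + l) + w * \<alpha> (n + k) (m + l)"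
proof -
  interpret rota_baxter_operator scale_xy w R by (rule RB)
  let ?x = "var_x :: 'a poly poly" and ?y = "var_y :: 'a poly poly"
  let ?Y = "?y ^ (n + m + k + l)"
  let ?a = "?x ^ n * ?y ^ m" and ?b = "?x ^ k * ?y ^ l"
  have "scale_xy (\<alpha> n m * \<alpha> k l) ?Y = R ?a * R ?b"
    by (simp add: form scale_xy_def power_add ac_simps)
  also have "\<dots> = R (R ?a * ?b + ?a * R ?b + scale_xy w (?a * ?b))"
    by (rule rota_baxter)
  also have "R ?a * ?b = scale_xy (\<alpha> n m) (?x ^ k * ?y ^ (n + m + l))"
    by (simp add: form scale_xy_def power_add ac_simps)
  also have "?a * R ?b = scale_xy (\<alpha> k l) (?x ^ n * ?y ^ (m + k + l))"
    by (simp add: form scale_xy_def power_add ac_simps)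
  also have "?a * ?b = ?x ^ (n + k) * ?y ^ (m + l)"
    by (simp add: power_add ac_simps)
  also have "R (scale_xy (\<alpha> n m) (?x ^ k * ?y ^ (n + m + l))
        + scale_xy (\<alpha> k l) (?x ^ n * ?y ^ (m + k + l))
        + scale_xy w (?x ^ (n + k) * ?y ^ (m + l)))
      = scale_xy (\<alpha> n m * \<alpha> k (n + m + l) + \<alpha> k l * \<alpha> n (m + k + l)
        + w * \<alpha> (n + k) (m + l)) ?Y"
    by (simp only: add scale form scale_scale scale_left_distrib ac_simps)
  finally show ?thesis
    by (simp only: scale_xy_var_y_power_eq_iff)
qed

text \<open>
  Completing the product in the relation for \<open>x y\<^sup>m\<close> and \<open>x y\<^sup>l\<close> gives
  \<open>w * \<alpha> 2 (m + l) + (\<alpha> 1 (m + l + 1))\<^sup>2\<close>, in which \<open>m\<close> and \<open>l\<close> enter only through their sum.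
\<close>

lemma degree_one_relation:
  fixes R :: "'a::field poly poly \<Rightarrow> 'a poly poly"
  assumes "rota_baxter_operator scale_xy w R"
    and "\<And>n m. R (var_x ^ n * var_y ^ m) = scale_xy (\<alpha> n m) (var_y ^ (n + m))"
  shows "(\<alpha> 1 m - \<alpha> 1 (m + l + 1)) * (\<alpha> 1 l - \<alpha> 1 (m + l + 1)) =
    w * \<alpha> 2 (m + l) + (\<alpha> 1 (m + l + 1))\<^sup>2"
  using rota_baxter_coefficient_relation [OF assms, of 1 m 1 l]
  by (simp add: algebra_simps power2_eq_square numeral_2_eq_2)

text \<open>
  In the normalisation \<open>s 0 = -1\<close>, \<open>s 1 = 0\<close> the quadratic terms in \<open>s (m + 2)\<close> of the products
  for \<open>(m + 1, 0)\<close> and \<open>(m, 1)\<close> cancel, so their equality determines \<open>s (m + 2)\<close> linearly.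
\<close>

lemma second_order_recursion:
  fixes s :: "nat \<Rightarrow> 'a::comm_ring_1"
  assumes sum_only: "\<And>m l. (s m - s (m + l + 1)) * (s l - s (m + l + 1)) = g (m + l)"
    and "s 0 = -1" "s 1 = 0"
  shows "s (m + 2) * (1 - s (m + 1) + s m) = s (m + 1)"
  using sum_only [of "m + 1" 0] sum_only [of m 1] assms(2,3)
  by (simp add: algebra_simps)

lemma first_order_recursion:
  fixes s :: "nat \<Rightarrow> 'a::field"
  assumes rec: "\<And>m. s (m + 2) * (1 - s (m + 1) + s m) = s (m + 1)"
    and init: "s 0 = -1" "s 1 = 0"
    and s2: "s 2 \<noteq> 0" "s 2 \<noteq> -1"
  shows "s (m + 1) * (1 / s 2 - s m) = s m + 1"
proof (induction m rule: induct_nat_012)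
  case 0
  then show ?case
    using init by simp
next
  case 1
  then show ?case
    using init s2 by (simp add: numeral_2_eq_2)
next
  case (ge2 m)
  define c where "c = 1 / s 2"
  have c: "c \<noteq> -1"
    using s2 by (auto simp: c_def field_simps minus_equation_iff)
  have IH0: "s (m + 1) * (c - s m) = s m + 1"
    and IH1: "s (m + 2) * (c - s (m + 1)) = s (m + 1) + 1"
    using ge2 by (simp_all add: c_def)
  have nz: "s (m + 2) \<noteq> 0"
  proof
    assume "s (m + 2) = 0"
    with IH1 have "s (m + 1) = -1"
      by (simp add: eq_neg_iff_add_eq_0)
    then have "c = s m - s (m + 1) * (c - s m)"
      by simp
    then have "c = -1"
      unfolding IH0 by simp
    with c show False ..
  qed
  \<comment> \<open>The factor \<open>1 + s (m + 2)\<close> makes \<open>s (m + 1)\<close> appear in the second order recursion only in the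
      combination that the induction hypothesis evaluates.\<close>
  have "s (m + 2) * (s (m + 3) * (c - s (m + 2))) =
      s (m + 3) * (1 - s (m + 2) * s (m + 2) + (s (m + 2) * c - 1))"
    by (simp add: algebra_simps)
  also have "s (m + 2) * c - 1 = s (m + 1) * (1 + s (m + 2))"
    using IH1 by (simp add: algebra_simps)
  also have "s (m + 3) * (1 - s (m + 2) * s (m + 2) + s (m + 1) * (1 + s (m + 2))) =
      s (m + 3) * (1 - s (m + 2) + s (m + 1)) * (1 + s (m + 2))"
    by (simp add: algebra_simps)
  also have "s (m + 3) * (1 - s (m + 2) + s (m + 1)) = s (m + 2)"
    using rec [of "m + 1"] by (simp add: numeral_3_eq_3)
  finally have "s (m + 3) * (c - s (m + 2)) = s (m + 2) + 1"
    using nz by (simp add: add.commute)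
  then show ?case
    by (simp add: c_def numeral_3_eq_3)
qed

theorem lemma7p6:
  fixes R :: "'a::field_char_0 poly poly \<Rightarrow> 'a poly poly"
    and \<alpha> :: "nat \<Rightarrow> nat \<Rightarrow> 'a"
    and s :: "nat \<Rightarrow> 'a"
  assumes RB: "rota_baxter_operator scale_xy 1 R"
    and form: "\<And>n m. R (var_x ^ n * var_y ^ m) = scale_xy (\<alpha> n m) (var_y ^ (n + m))"
    and image: "\<not> range R \<subseteq> constants_xy"
    and distinct: "\<alpha> 1 0 \<noteq> \<alpha> 1 1" "\<alpha> 1 0 \<noteq> \<alpha> 1 2" "\<alpha> 1 1 \<noteq> \<alpha> 1 2"
    and s: "\<And>i. s i = (\<alpha> 1 1 - \<alpha> 1 i) / (\<alpha> 1 0 - \<alpha> 1 1)"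
    and s2: "s 2 \<noteq> 0" "s 2 \<noteq> -1"
  shows "\<forall>m. s (m + 1) * (1 / s 2 - s m) = s m + 1"
proof
  fix m
  define d where "d = \<alpha> 1 1 - \<alpha> 1 0"
  have d: "d \<noteq> 0"
    using distinct by (simp add: d_def)
  have s_d: "s i = (\<alpha> 1 i - \<alpha> 1 1) / d" for i
    using minus_divide_divide [of "\<alpha> 1 1 - \<alpha> 1 i" "\<alpha> 1 0 - \<alpha> 1 1"]
    by (simp add: s d_def)
  have init: "s 0 = -1" "s 1 = 0"
    using d by (simp_all add: s_d d_def field_simps)
  have diff: "s i - s j = (\<alpha> 1 i - \<alpha> 1 j) / d" for i j
    by (simp add: s_d diff_divide_distrib [symmetric])
  have "(s m - s (m + l + 1)) * (s l - s (m + l + 1)) =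
      (\<alpha> 2 (m + l) + (\<alpha> 1 (m + l + 1))\<^sup>2) / d\<^sup>2" for m l
    unfolding diff times_divide_times_eq degree_one_relation [OF RB form]
    by (simp add: power2_eq_square)
  then have "s (m + 2) * (1 - s (m + 1) + s m) = s (m + 1)" for m
    using init by (rule second_order_recursion)
  then show "s (m + 1) * (1 / s 2 - s m) = s m + 1"
    using init s2 by (rule first_order_recursion)
qed

end
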